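(* (Legendre coherence lemma.) Let $L(x,v)$ be an admissible Lagrangian system possessing the Legendre property, with Legendre transform $f$ and associated Hamiltonian function $H$. Then the diagram $$\begin{array}{ccc}(x,p)&\xrightarrow{\ H\ }&H(x,p)\\ {\scriptstyle S_H}\downarrow & &\downarrow{\scriptstyle S_H}\\ (X,P)&\xrightarrow{\ H_S\ }&H(X,P)\end{array}$$ commutes; that is, the Hamiltonian stochastic embedding $H_S$ of the Hamiltonian function $H$ coincides with the stochastic Hamiltonian system $(P,X)\mapsto Pf(X,P)-L(X,f(X,P))$ associated to $L$, where $P(t)=\frac{\partial L}{\partial v}(X(t),\mathcal{D}X(t))$ is the canonical momentum process of $X\in\mathcal{C}^1(I)$.
   Context: $(\Omega,\mathcal{A},P)$ is a probability space, $I=(a,b)$, with an increasing family $(\mathcal{P}_t)$ and a decreasing family $(\mathcal{F}_t)$ of sub-$\sigma$-algebras; processes are both $\mathcal{P}_t$- and $\mathcal{F}_t$-adapted. Nelson derivatives (limits in $L^1(\Omega)$): $DX(t)=\lim_{h\to0^+}E[\frac{X(t+h)-X(t)}{h}\mid\mathcal{P}_t]$, $D_*X(t)=\lim_{h\to0^+}E[\frac{X(t)-X(t-h)}{h}\mid\mathcal{F}_t]$. $\mathcal{C}^1(I)$ is the set (completed in the norm $\sup_t(\|X\|_{L^2}+\|DX\|_{L^2}+\|D_*X\|_{L^2})$) of $\mathbb{R}^d$-valued processes with continuous paths such that $X(t),DX(t),D_*X(t)$ exist, lie in $L^2(\Omega)$ and are continuous in $t$ in $L^2(\Omega)$, and such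 that $\lim_{h\to 0^+}E[(X(t+h)-X(t))^2/h\mid\mathcal{P}_t]$ and $\lim_{h\to0^+}E[(X(t+h)-X(t))^2/h\mid\mathcal{F}_t]$ exist in $L^1(\Omega)$. $\mathcal{P}_{\mathbb{C}}$ denotes the complex valued processes. The stochastic derivative is $\mathcal{D}=\frac{D+D_*}{2}+i\mu\frac{D-D_*}{2}$, $\mu=\pm1$ fixed. An admissible Lagrangian is a function $L(x,v)$ on $\mathbb{R}^d\times\mathbb{C}^d$ (not depending on time), holomorphic in $v$ and real for real $v$. For a $C^1$ curve $x$ its momentum is $p=\frac{\partial L}{\partial v}(x,\dot x)$. $L$ possesses the Legendre property if there is a function $f$ (the Legendre transform) with $\dot x=f(x,p)$ for all $x\in C^1$. The associated Hamiltonian is $H(x,p)=p\,f(x,p)-L(x,f(x,p))$; $f$ and $H$ are considered on $\mathbb{R}^d\times\mathbb{C}^d$, holomorphic, with real values at real arguments. The stochastic Hamiltonian system associated to $L$ is the map $\mathcal{P}_{\mathbb{C}}\times\mathcal{C}^1(I)\to\mathcal{P}_{\mathbb{C}}$, $(P,X)\mapsto Pf(X,P)-L(X,f(X,P))$. Hamiltonian stochastic embedding $S_H$: for a holomorphic function $F:\mathbb{R}^d\times\mathbb{C}^d\to\mathbb{C}$, real valued on real arguments, viewed as a functional on $C^1(I)\times C^1(I)$, $S_H$ associates the functional $F_S$ on $\mathcal{C}^1(I)\times\mathcal{P}_{\mathbb{C}}$ given by $F_S(X,P)(t)=F(X(t),P(t))$. On variables, $S_H$ replaces $(x,p)$ by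 $(X,P)$ with $P$ the canonical momentum process. *)

theory Defs
  imports "HOL-Probability.Probability" "HOL-Complex_Analysis.Conformal_Mappings"
begin

section \<open>Probability space with a past and a future filtration\<close>

locale nelson_setting = prob_space M
  for M :: "'w measure" +
  fixes a b :: real
    and Pt Ft :: "real \<Rightarrow> 'w measure"
  assumes a_less_b: "a < b"
    and subalgebra_Pt: "t \<in> {a<..<b} \<Longrightarrow> subalgebra M (Pt t)"
    and subalgebra_Ft: "t \<in> {a<..<b} \<Longrightarrow> subalgebra M (Ft t)"
    and Pt_increasing:
      "s \<in> {a<..<b} \<Longrightarrow> t \<in> {a<..<b} \<Longrightarrow> s \<le> t \<Longrightarrow> sets (Pt s) \<subseteq> sets (Pt t)"
    and Ft_decreasing:
      "s \<in> {a<..<b} \<Longrightarrow> t \<in> {a<..<b} \<Longrightarrow> s \<le> t \<Longrightarrow> sets (Ft t) \<subseteq> sets (Ft s)"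

definition processes ::
  "real set \<Rightarrow> (real \<Rightarrow> 'w measure) \<Rightarrow> (real \<Rightarrow> 'w measure) \<Rightarrow> (real \<Rightarrow> 'w \<Rightarrow> 'v::topological_space) set"
  where "processes I Pt Ft =
    {X. \<forall>t\<in>I. X t \<in> borel_measurable (Pt t) \<and> X t \<in> borel_measurable (Ft t)}"


section \<open>Nelson derivatives and the space of stochastically differentiable processes\<close>

definition square_integrable :: "'w measure \<Rightarrow> ('w \<Rightarrow> 'v::euclidean_space) \<Rightarrow> bool"
  where "square_integrable M Z \<longleftrightarrow>
    Z \<in> borel_measurable M \<and> integrable M (\<lambda>\<omega>. (norm (Z \<omega>))\<^sup>2)"

definition L2_norm :: "'w measure \<Rightarrow> ('w \<Rightarrow> 'v::euclidean_space) \<Rightarrow> real"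
  where "L2_norm M Z = sqrt (\<integral>\<omega>. (norm (Z \<omega>))\<^sup>2 \<partial>M)"

definition L2_continuous_on ::
  "'w measure \<Rightarrow> real set \<Rightarrow> (real \<Rightarrow> 'w \<Rightarrow> 'v::euclidean_space) \<Rightarrow> bool"
  where "L2_continuous_on M I Z \<longleftrightarrow>
    (\<forall>t\<in>I. ((\<lambda>s. L2_norm M (\<lambda>\<omega>. Z s \<omega> - Z t \<omega>)) \<longlongrightarrow> 0) (at t within I))"

definition L1_limit ::
  "'w measure \<Rightarrow> (real \<Rightarrow> 'w \<Rightarrow> 'v::euclidean_space) \<Rightarrow> ('w \<Rightarrow> 'v) \<Rightarrow> real filter \<Rightarrow> bool"
  where "L1_limit M Q Z G \<longleftrightarrow>
    integrable M Z \<and> (\<forall>\<^sub>F h in G. integrable M (Q h)) \<and>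
    ((\<lambda>h. \<integral>\<omega>. norm (Q h \<omega> - Z \<omega>) \<partial>M) \<longlongrightarrow> 0) G"

definition vec_cond_exp ::
  "'w measure \<Rightarrow> 'w measure \<Rightarrow> ('w \<Rightarrow> real ^ 'd) \<Rightarrow> ('w \<Rightarrow> real ^ 'd)"
  where "vec_cond_exp M G Z = (\<lambda>\<omega>. \<chi> i. real_cond_exp M G (\<lambda>\<omega>'. Z \<omega>' $ i) \<omega>)"

definition has_forward_derivative ::
  "'w measure \<Rightarrow> (real \<Rightarrow> 'w measure) \<Rightarrow> (real \<Rightarrow> 'w \<Rightarrow> real ^ 'd) \<Rightarrow> real \<Rightarrow> ('w \<Rightarrow> real ^ 'd) \<Rightarrow> bool"
  where "has_forward_derivative M Pt X t Z \<longleftrightarrow>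
    L1_limit M (\<lambda>h. vec_cond_exp M (Pt t) (\<lambda>\<omega>. (X (t + h) \<omega> - X t \<omega>) /\<^sub>R h)) Z (at_right 0)"

definition has_backward_derivative ::
  "'w measure \<Rightarrow> (real \<Rightarrow> 'w measure) \<Rightarrow> (real \<Rightarrow> 'w \<Rightarrow> real ^ 'd) \<Rightarrow> real \<Rightarrow> ('w \<Rightarrow> real ^ 'd) \<Rightarrow> bool"
  where "has_backward_derivative M Ft X t Z \<longleftrightarrow>
    L1_limit M (\<lambda>h. vec_cond_exp M (Ft t) (\<lambda>\<omega>. (X t \<omega> - X (t - h) \<omega>) /\<^sub>R h)) Z (at_right 0)"

text \<open>An \<open>L\<^sup>1\<close> limit is determined up to equality almost everywhere; the operators below
  fix one representative.\<close>

definition forward_derivative ::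
  "'w measure \<Rightarrow> (real \<Rightarrow> 'w measure) \<Rightarrow> (real \<Rightarrow> 'w \<Rightarrow> real ^ 'd) \<Rightarrow> real \<Rightarrow> 'w \<Rightarrow> real ^ 'd"
  where "forward_derivative M Pt X t = (SOME Z. has_forward_derivative M Pt X t Z)"

definition backward_derivative ::
  "'w measure \<Rightarrow> (real \<Rightarrow> 'w measure) \<Rightarrow> (real \<Rightarrow> 'w \<Rightarrow> real ^ 'd) \<Rightarrow> real \<Rightarrow> 'w \<Rightarrow> real ^ 'd"
  where "backward_derivative M Ft X t = (SOME Z. has_backward_derivative M Ft X t Z)"

definition nelson_differentiable ::
  "'w measure \<Rightarrow> real set \<Rightarrow> (real \<Rightarrow> 'w measure) \<Rightarrow> (real \<Rightarrow> 'w measure) \<Rightarrow> (real \<Rightarrow> 'w \<Rightarrow> real ^ 'd) set"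
  where "nelson_differentiable M I Pt Ft =
    {X \<in> processes I Pt Ft. \<forall>t\<in>I.
       (\<exists>Z. has_forward_derivative M Pt X t Z) \<and>
       (\<exists>Z. has_backward_derivative M Ft X t Z) \<and>
       square_integrable M (X t) \<and>
       square_integrable M (forward_derivative M Pt X t) \<and>
       square_integrable M (backward_derivative M Ft X t)}"

text \<open>The square of a vector-valued increment is its squared Euclidean norm.\<close>

definition C1_pre ::
  "'w measure \<Rightarrow> real set \<Rightarrow> (real \<Rightarrow> 'w measure) \<Rightarrow> (real \<Rightarrow> 'w measure) \<Rightarrow> (real \<Rightarrow> 'w \<Rightarrow> real ^ 'd) set"
  where "C1_pre M I Pt Ft =
    {X \<in> nelson_differentiable M I Pt Ft.
       (\<forall>\<omega>\<in>space M. continuous_on I (\<lambda>t. X t \<omega>)) \<and>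
       L2_continuous_on M I X \<and>
       L2_continuous_on M I (forward_derivative M Pt X) \<and>
       L2_continuous_on M I (backward_derivative M Ft X) \<and>
       (\<forall>t\<in>I. \<exists>Z. L1_limit M
          (\<lambda>h. real_cond_exp M (Pt t) (\<lambda>\<omega>. (norm (X (t + h) \<omega> - X t \<omega>))\<^sup>2 / h)) Z (at_right 0)) \<and>
       (\<forall>t\<in>I. \<exists>Z. L1_limit M
          (\<lambda>h. real_cond_exp M (Ft t) (\<lambda>\<omega>. (norm (X (t + h) \<omega> - X t \<omega>))\<^sup>2 / h)) Z (at_right 0))}"

definition C1_norm ::
  "'w measure \<Rightarrow> real set \<Rightarrow> (real \<Rightarrow> 'w measure) \<Rightarrow> (real \<Rightarrow> 'w measure) \<Rightarrow> (real \<Rightarrow> 'w \<Rightarrow> real ^ 'd) \<Rightarrow> ennreal"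
  where "C1_norm M I Pt Ft X =
    (\<Squnion>t\<in>I. ennreal (L2_norm M (X t) + L2_norm M (forward_derivative M Pt X t)
                     + L2_norm M (backward_derivative M Ft X t)))"

text \<open>The completion of \<^const>\<open>C1_pre\<close> is realised by processes: a Cauchy sequence for
  \<^const>\<open>C1_norm\<close> converges in \<open>L\<^sup>2\<close>, uniformly in time, together with its forward and backward
  derivatives, and as the operators \<open>D\<close> and \<open>D\<^sub>*\<close> are closed for this convergence the
  completion is the closure of \<^const>\<open>C1_pre\<close> in the Nelson differentiable processes.
  Path continuity and the existence of the conditional second moments need not survive in the
  limit, so they are not demanded of its elements.\<close>

definition C1_processes ::
  "'w measure \<Rightarrow> real set \<Rightarrow> (real \<Rightarrow> 'w measure) \<Rightarrow> (real \<Rightarrow> 'w measure) \<Rightarrow> (real \<Rightarrow> 'w \<Rightarrow> real ^ 'd) set"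
  where "C1_processes M I Pt Ft =
    {X \<in> nelson_differentiable M I Pt Ft.
       \<exists>Y. (\<forall>n::nat. Y n \<in> C1_pre M I Pt Ft) \<and>
           (\<lambda>n. C1_norm M I Pt Ft (\<lambda>t \<omega>. Y n t \<omega> - X t \<omega>)) \<longlonglongrightarrow> 0}"

definition stochastic_derivative ::
  "real \<Rightarrow> 'w measure \<Rightarrow> (real \<Rightarrow> 'w measure) \<Rightarrow> (real \<Rightarrow> 'w measure) \<Rightarrow> (real \<Rightarrow> 'w \<Rightarrow> real ^ 'd)
     \<Rightarrow> real \<Rightarrow> 'w \<Rightarrow> complex ^ 'd"
  where "stochastic_derivative \<mu> M Pt Ft X t \<omega> =
    (\<chi> i. let D = complex_of_real (forward_derivative M Pt X t \<omega> $ i);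
              D' = complex_of_real (backward_derivative M Ft X t \<omega> $ i)
          in (D + D') / 2 + \<i> * of_real \<mu> * ((D - D') / 2))"


section \<open>Lagrangians, Legendre transform and Hamiltonian\<close>

definition cvec :: "real ^ 'd \<Rightarrow> complex ^ 'd"
  where "cvec v = (\<chi> i. complex_of_real (v $ i))"

definition entire_vec :: "(complex ^ 'd \<Rightarrow> complex) \<Rightarrow> bool"
  where "entire_vec g \<longleftrightarrow>
    (\<forall>p. \<exists>A. (g has_derivative A) (at p) \<and> (\<forall>c v. A (c *s v) = c * A v))"

definition holomorphic_real :: "(real ^ 'd \<Rightarrow> complex ^ 'd \<Rightarrow> complex) \<Rightarrow> bool"
  where "holomorphic_real F \<longleftrightarrow>
    (\<forall>x. entire_vec (F x)) \<and> (\<forall>x v. F x (cvec v) \<in> \<real>)"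

definition admissible_lagrangian :: "(real ^ 'd \<Rightarrow> complex ^ 'd \<Rightarrow> complex) \<Rightarrow> bool"
  where "admissible_lagrangian L \<longleftrightarrow> holomorphic_real L"

definition grad_v ::
  "(real ^ 'd \<Rightarrow> complex ^ 'd \<Rightarrow> complex) \<Rightarrow> real ^ 'd \<Rightarrow> complex ^ 'd \<Rightarrow> complex ^ 'd"
  where "grad_v L x v = (\<chi> i. deriv (\<lambda>z. L x (v + axis i z)) 0)"

definition curve_momentum ::
  "(real ^ 'd \<Rightarrow> complex ^ 'd \<Rightarrow> complex) \<Rightarrow> (real \<Rightarrow> real ^ 'd) \<Rightarrow> real \<Rightarrow> complex ^ 'd"
  where "curve_momentum L x t = grad_v L (x t) (cvec (vector_derivative x (at t)))"

definition legendre_transform ::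
  "real set \<Rightarrow> (real ^ 'd \<Rightarrow> complex ^ 'd \<Rightarrow> complex) \<Rightarrow> (real ^ 'd \<Rightarrow> complex ^ 'd \<Rightarrow> complex ^ 'd) \<Rightarrow> bool"
  where "legendre_transform I L f \<longleftrightarrow>
    (\<forall>i. holomorphic_real (\<lambda>x p. f x p $ i)) \<and>
    (\<forall>x. x C1_differentiable_on I \<longrightarrow>
       (\<forall>t\<in>I. cvec (vector_derivative x (at t)) = f (x t) (curve_momentum L x t)))"

text \<open>The product \<open>p f(x,p)\<close> is the bilinear (not Hermitian) pairing, as holomorphy in \<open>p\<close> requires.\<close>

definition hamiltonian ::
  "(real ^ 'd \<Rightarrow> complex ^ 'd \<Rightarrow> complex) \<Rightarrow> (real ^ 'd \<Rightarrow> complex ^ 'd \<Rightarrow> complex ^ 'd)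
     \<Rightarrow> real ^ 'd \<Rightarrow> complex ^ 'd \<Rightarrow> complex"
  where "hamiltonian L f x p = (\<Sum>i\<in>UNIV. p $ i * f x p $ i) - L x (f x p)"


section \<open>Hamiltonian stochastic embedding\<close>

definition curve_functional ::
  "(real ^ 'd \<Rightarrow> complex ^ 'd \<Rightarrow> complex) \<Rightarrow> (real \<Rightarrow> real ^ 'd) \<Rightarrow> (real \<Rightarrow> real ^ 'd) \<Rightarrow> real \<Rightarrow> complex"
  where "curve_functional F x p t = F (x t) (cvec (p t))"

definition functional_of ::
  "real set \<Rightarrow> ((real \<Rightarrow> real ^ 'd) \<Rightarrow> (real \<Rightarrow> real ^ 'd) \<Rightarrow> real \<Rightarrow> complex)
     \<Rightarrow> (real ^ 'd \<Rightarrow> complex ^ 'd \<Rightarrow> complex) \<Rightarrow> bool"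
  where "functional_of I \<Phi> F \<longleftrightarrow> holomorphic_real F \<and>
    (\<forall>x p. x C1_differentiable_on I \<longrightarrow> p C1_differentiable_on I \<longrightarrow>
       (\<forall>t\<in>I. \<Phi> x p t = curve_functional F x p t))"

text \<open>The embedding acts on functionals of real curves that come from a holomorphic function.
  That function is unique, see \<open>functional_of_unique\<close>, and its action on the functional of \<open>F\<close> is
  the substitution of \<open>(X, P)\<close> into \<open>F\<close>, see \<open>S_H_curve_functional\<close>.\<close>

definition S_H ::
  "real set \<Rightarrow> ((real \<Rightarrow> real ^ 'd) \<Rightarrow> (real \<Rightarrow> real ^ 'd) \<Rightarrow> real \<Rightarrow> complex)
     \<Rightarrow> (real \<Rightarrow> 'w \<Rightarrow> real ^ 'd) \<Rightarrow> (real \<Rightarrow> 'w \<Rightarrow> complex ^ 'd) \<Rightarrow> real \<Rightarrow> 'w \<Rightarrow> complex"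
  where "S_H I \<Phi> X P t \<omega> = (THE F. functional_of I \<Phi> F) (X t \<omega>) (P t \<omega>)"

lemma entire_vec_line:
  fixes g :: "complex ^ 'd \<Rightarrow> complex"
  assumes "entire_vec g"
  shows "(\<lambda>z. g (u + z *s w)) holomorphic_on UNIV"
proof -
  have "(\<lambda>z. g (u + z *s w)) field_differentiable (at z)" for z
  proof -
    obtain A where A: "(g has_derivative A) (at (u + z *s w))" "\<And>c v. A (c *s v) = c * A v"
      using assms unfolding entire_vec_def by blast
    have "linear (\<lambda>z. z *s w)"
      by (rule linearI) (simp_all add: vec_eq_iff algebra_simps)
    then have "bounded_linear (\<lambda>z. z *s w)"
      by (simp add: linear_conv_bounded_linear)
    then have "((\<lambda>z. u + z *s w) has_derivative (\<lambda>h. h *s w)) (at z)"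
      by (auto intro!: derivative_eq_intros bounded_linear_imp_has_derivative)
    from has_derivative_compose[OF this A(1)]
    have "((\<lambda>z. g (u + z *s w)) has_derivative (\<lambda>h. A w * h)) (at z)"
      by (simp add: A(2) mult.commute)
    then show ?thesis
      unfolding field_differentiable_def has_field_derivative_def by blast
  qed
  then show ?thesis
    by (simp add: holomorphic_on_def)
qed

lemma entire_vec_eqI:
  fixes g h :: "complex ^ 'd \<Rightarrow> complex"
  assumes "entire_vec g" "entire_vec h" and eq: "\<And>v. g (cvec v) = h (cvec v)"
  shows "g = h"
proof
  fix p
  define u w :: "complex ^ 'd" where "u = cvec (\<chi> i. Re (p $ i))" and "w = cvec (\<chi> i. Im (p $ i))"
  let ?k = "\<lambda>z. g (u + z *s w) - h (u + z *s w)"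
  have hol: "?k holomorphic_on UNIV"
    by (intro holomorphic_on_diff entire_vec_line assms)
  have "?k z = 0" if "z \<in> \<real>" for z
  proof -
    from that obtain r where "z = of_real r" by (rule Reals_cases)
    then have "u + z *s w = cvec (\<chi> i. Re (p $ i) + r * Im (p $ i))"
      by (simp add: u_def w_def cvec_def vec_eq_iff)
    then show ?thesis using eq by simp
  qed
  moreover have "(0::complex) islimpt \<real>"
    unfolding islimpt_approachable
  proof safe
    fix e :: real assume "e > 0"
    then show "\<exists>x'\<in>\<real>. x' \<noteq> (0::complex) \<and> dist x' 0 < e"
      by (intro bexI[of _ "of_real (e / 2)"] conjI) (simp_all add: norm_divide)
  qed
  ultimately have "?k \<i> = 0"
    by (rule analytic_continuation[OF hol open_UNIV connected_UNIV subset_UNIV UNIV_I _ _ UNIV_I, rotated])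
  moreover have "u + \<i> *s w = p"
    by (simp add: u_def w_def cvec_def vec_eq_iff complex_eq_iff)
  ultimately show "g p = h p" by simp
qed

lemma functional_of_unique:
  fixes F G :: "real ^ 'd \<Rightarrow> complex ^ 'd \<Rightarrow> complex"
  assumes F: "functional_of I \<Phi> F" and G: "functional_of I \<Phi> G" and I: "I \<noteq> {}"
  shows "F = G"
proof
  fix x
  from I obtain t where t: "t \<in> I" by blast
  show "F x = G x"
  proof (rule entire_vec_eqI)
    show "entire_vec (F x)" "entire_vec (G x)"
      using F G by (auto simp: functional_of_def holomorphic_real_def)
    fix v
    have const: "(\<lambda>_. y) C1_differentiable_on I" for y :: "real ^ 'd"
      by simp
    have "\<Phi> (\<lambda>_. x) (\<lambda>_. v) t = K x (cvec v)" if "functional_of I \<Phi> K" for K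
      using that t const[of x] const[of v]
      unfolding functional_of_def curve_functional_def by blast
    from this[OF F] this[OF G] show "F x (cvec v) = G x (cvec v)" by simp
  qed
qed

lemma S_H_curve_functional:
  assumes "holomorphic_real F" "I \<noteq> {}"
  shows "S_H I (curve_functional F) X P t \<omega> = F (X t \<omega>) (P t \<omega>)"
proof -
  have "functional_of I (curve_functional F) F"
    using assms by (simp add: functional_of_def)
  then have "(THE G. functional_of I (curve_functional F) G) = F"
    by (intro the_equality functional_of_unique[OF _ _ assms(2)])
  then show ?thesis by (simp add: S_H_def)
qed

definition stochastic_hamiltonian_system ::
  "(real ^ 'd \<Rightarrow> complex ^ 'd \<Rightarrow> complex) \<Rightarrow> (real ^ 'd \<Rightarrow> complex ^ 'd \<Rightarrow> complex ^ 'd)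
     \<Rightarrow> (real \<Rightarrow> 'w \<Rightarrow> complex ^ 'd) \<Rightarrow> (real \<Rightarrow> 'w \<Rightarrow> real ^ 'd) \<Rightarrow> real \<Rightarrow> 'w \<Rightarrow> complex"
  where "stochastic_hamiltonian_system L f P X t \<omega> =
    (\<Sum>i\<in>UNIV. P t \<omega> $ i * f (X t \<omega>) (P t \<omega>) $ i) - L (X t \<omega>) (f (X t \<omega>) (P t \<omega>))"

definition canonical_momentum ::
  "real \<Rightarrow> 'w measure \<Rightarrow> (real \<Rightarrow> 'w measure) \<Rightarrow> (real \<Rightarrow> 'w measure)
     \<Rightarrow> (real ^ 'd \<Rightarrow> complex ^ 'd \<Rightarrow> complex) \<Rightarrow> (real \<Rightarrow> 'w \<Rightarrow> real ^ 'd) \<Rightarrow> real \<Rightarrow> 'w \<Rightarrow> complex ^ 'd"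
  where "canonical_momentum \<mu> M Pt Ft L X t \<omega> =
    grad_v L (X t \<omega>) (stochastic_derivative \<mu> M Pt Ft X t \<omega>)"

end

theory Submission
  imports Defs
begin

text \<open>
  Consider the functions that are entire in the complex variable and real at real arguments. The
  Lagrangian and the coordinates of its Legendre transform are of this kind, and the pairing
  \<open>p f(x, p)\<close> and the composition \<open>L(x, f(x, p))\<close> stay of this kind, hence so is the Hamiltonian
  \<open>H\<close> (\<open>holomorphic_real_hamiltonian\<close>). By the identity theorem a function of this class
  is determined by its values on real curves, so \<open>S_H\<close> recovers \<open>H\<close> from the functional
  \<open>(x, p) \<mapsto> H(x, p)\<close> and substitutes \<open>(X, P)\<close> into it. What results is
  \<open>P f(X, P) - L(X, f(X, P))\<close>, at every time and at every sample point. Substitution is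
  pointwise, so a momentum process enters only through its value \<open>P(t)(\<omega>)\<close>, an arbitrary complex
  vector: this is why the values of \<open>H\<close> off the real arguments matter, and why the canonical momentum
  process is treated exactly like any other.
\<close>

text \<open>
  Finitely many coordinates suffice to bound the candidate derivative and to control the
  remainder; the coordinates may lie in any normed space, as in the case of complex vectors.
\<close>

lemma has_derivative_vec_lambda:
  fixes g :: "'a::real_normed_vector \<Rightarrow> 'b::real_normed_vector ^ 'n"
  assumes "\<And>i. ((\<lambda>p. g p $ i) has_derivative A i) (at p)"
  shows "(g has_derivative (\<lambda>h. \<chi> i. A i h)) (at p)"
  unfolding has_derivative_def
proof
  have lin: "linear (A i)" for i
    using assms[of i] by (blast dest: has_derivative_bounded_linear bounded_linear.linear)
  obtain K where K: "\<And>i h. norm (A i h) \<le> norm h * K i"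
  proof -
    have "\<exists>k. \<forall>h. norm (A i h) \<le> norm h * k" for i
      using has_derivative_bounded_linear[OF assms, THEN bounded_linear.bounded] by blast
    then show ?thesis using that by metis
  qed
  show "bounded_linear (\<lambda>h. \<chi> i. A i h)"
  proof (rule bounded_linear_intro[where K = "\<Sum>i\<in>UNIV. K i"])
    fix h
    have "norm (\<chi> i. A i h) \<le> (\<Sum>i\<in>UNIV. norm (A i h))"
      unfolding norm_vec_def by (simp add: L2_set_le_sum)
    also have "\<dots> \<le> norm h * (\<Sum>i\<in>UNIV. K i)"
      unfolding sum_distrib_left by (intro sum_mono K)
    finally show "norm (\<chi> i. A i h) \<le> norm h * (\<Sum>i\<in>UNIV. K i)" .
  qed (simp_all add: vec_eq_iff linear_add[OF lin] linear_scale[OF lin])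
  show "((\<lambda>y. ((g y - g (Lim (at p) (\<lambda>x. x))) - (\<chi> i. A i (y - Lim (at p) (\<lambda>x. x))))
          /\<^sub>R norm (y - Lim (at p) (\<lambda>x. x))) \<longlongrightarrow> 0) (at p)"
    using assms by (intro vec_tendstoI) (simp add: has_derivative_def)
qed

text \<open>
  The inner derivative, assembled from complex linear coordinates, is complex linear as a map
  between vectors, so the chain rule yields a complex linear derivative.
\<close>

lemma entire_vec_compose:
  fixes g :: "complex ^ 'n \<Rightarrow> complex" and f :: "complex ^ 'm \<Rightarrow> complex ^ 'n"
  assumes g: "entire_vec g" and f: "\<And>i. entire_vec (\<lambda>p. f p $ i)"
  shows "entire_vec (\<lambda>p. g (f p))"
  unfolding entire_vec_def
proof
  fix p
  obtain B where B: "(g has_derivative B) (at (f p))" "\<And>c v. B (c *s v) = c * B v"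
    using g unfolding entire_vec_def by blast
  have "\<exists>A. ((\<lambda>p. f p $ i) has_derivative A) (at p) \<and> (\<forall>c v. A (c *s v) = c * A v)" for i
    using f[of i] unfolding entire_vec_def by blast
  then obtain A where A: "\<And>i. ((\<lambda>p. f p $ i) has_derivative A i) (at p)"
      "\<And>i c v. A i (c *s v) = c * A i v"
    by metis
  have "((\<lambda>p. g (f p)) has_derivative (\<lambda>h. B (\<chi> i. A i h))) (at p)"
    by (rule has_derivative_compose[OF has_derivative_vec_lambda[OF A(1)] B(1)])
  moreover have "B (\<chi> i. A i (c *s v)) = c * B (\<chi> i. A i v)" for c v
  proof -
    have "(\<chi> i. A i (c *s v)) = c *s (\<chi> i. A i v)"
      by (simp add: vec_eq_iff A(2))
    then show ?thesis by (simp add: B(2))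
  qed
  ultimately show "\<exists>A. ((\<lambda>p. g (f p)) has_derivative A) (at p) \<and> (\<forall>c v. A (c *s v) = c * A v)"
    by blast
qed

lemma entire_vec_component: "entire_vec (\<lambda>p. p $ i)"
  unfolding entire_vec_def
  by (auto intro!: exI[of _ "\<lambda>h. h $ i"] bounded_linear_imp_has_derivative bounded_linear_vec_nth)

lemma entire_vec_diff:
  assumes "entire_vec g" "entire_vec h"
  shows "entire_vec (\<lambda>p. g p - h p)"
  unfolding entire_vec_def
proof
  fix p
  obtain A B where "(g has_derivative A) (at p)" "\<And>c v. A (c *s v) = c * A v"
      "(h has_derivative B) (at p)" "\<And>c v. B (c *s v) = c * B v"
    using assms unfolding entire_vec_def by metis
  then show "\<exists>A. ((\<lambda>p. g p - h p) has_derivative A) (at p) \<and> (\<forall>c v. A (c *s v) = c * A v)"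
    by (intro exI[of _ "\<lambda>v. A v - B v"]) (auto intro: has_derivative_diff simp: algebra_simps)
qed

lemma entire_vec_mult:
  assumes "entire_vec g" "entire_vec h"
  shows "entire_vec (\<lambda>p. g p * h p)"
  unfolding entire_vec_def
proof
  fix p
  obtain A B where "(g has_derivative A) (at p)" "\<And>c v. A (c *s v) = c * A v"
      "(h has_derivative B) (at p)" "\<And>c v. B (c *s v) = c * B v"
    using assms unfolding entire_vec_def by metis
  then show "\<exists>A. ((\<lambda>p. g p * h p) has_derivative A) (at p) \<and> (\<forall>c v. A (c *s v) = c * A v)"
    by (intro exI[of _ "\<lambda>v. g p * B v + A v * h p"] conjI has_derivative_mult)
      (simp_all add: algebra_simps)
qed

lemma entire_vec_sum:
  assumes "\<And>i. i \<in> S \<Longrightarrow> entire_vec (g i)"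
  shows "entire_vec (\<lambda>p. \<Sum>i\<in>S. g i p)"
  unfolding entire_vec_def
proof
  fix p
  have "\<forall>i\<in>S. \<exists>A. (g i has_derivative A) (at p) \<and> (\<forall>c v. A (c *s v) = c * A v)"
    using assms unfolding entire_vec_def by blast
  then obtain A where "\<forall>i\<in>S. (g i has_derivative A i) (at p) \<and> (\<forall>c v. A i (c *s v) = c * A i v)"
    by metis
  then show "\<exists>A. ((\<lambda>p. \<Sum>i\<in>S. g i p) has_derivative A) (at p) \<and> (\<forall>c v. A (c *s v) = c * A v)"
    by (intro exI[of _ "\<lambda>v. \<Sum>i\<in>S. A i v"])
      (auto intro: has_derivative_sum simp: sum_distrib_left)
qed

text \<open>
  At a real momentum the velocity \<open>f(x, p)\<close> is again a real vector, so \<open>L\<close> is evaluated there at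
  a real argument and takes a real value.
\<close>

lemma holomorphic_real_hamiltonian:
  assumes L: "holomorphic_real L" and f: "\<And>i. holomorphic_real (\<lambda>x p. f x p $ i)"
  shows "holomorphic_real (hamiltonian L f)"
  unfolding holomorphic_real_def
proof (intro conjI allI)
  fix x
  have entire: "entire_vec (L x)" "\<And>i. entire_vec (\<lambda>p. f x p $ i)"
    using L f by (auto simp: holomorphic_real_def)
  show "entire_vec (hamiltonian L f x)"
    unfolding hamiltonian_def
    by (intro entire_vec_diff entire_vec_sum entire_vec_mult entire_vec_component entire
        entire_vec_compose[OF entire])
next
  fix x v
  have f_real: "f x (cvec v) $ i \<in> \<real>" for i
    using f by (simp add: holomorphic_real_def)
  then have f_cvec: "cvec (\<chi> i. Re (f x (cvec v) $ i)) = f x (cvec v)"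
    by (simp add: cvec_def vec_eq_iff of_real_Re)
  have "L x (cvec (\<chi> i. Re (f x (cvec v) $ i))) \<in> \<real>"
    using L by (simp add: holomorphic_real_def)
  then have "L x (f x (cvec v)) \<in> \<real>"
    unfolding f_cvec .
  moreover have "cvec v $ i \<in> \<real>" for i
    by (simp add: cvec_def)
  ultimately show "hamiltonian L f x (cvec v) \<in> \<real>"
    unfolding hamiltonian_def by (intro Reals_diff sum_in_Reals Reals_mult f_real)
qed

theorem lemma10p2:
  fixes M :: "'w measure" and a b \<mu> :: real and Pt Ft :: "real \<Rightarrow> 'w measure"
    and L :: "real ^ 'd \<Rightarrow> complex ^ 'd \<Rightarrow> complex"
    and f :: "real ^ 'd \<Rightarrow> complex ^ 'd \<Rightarrow> complex ^ 'd"
    and H :: "real ^ 'd \<Rightarrow> complex ^ 'd \<Rightarrow> complex"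
  assumes "nelson_setting M a b Pt Ft"
    and "\<mu> = 1 \<or> \<mu> = - 1"
    and "admissible_lagrangian L"
    and "legendre_transform {a<..<b} L f"
    and "H = hamiltonian L f"
  shows "\<forall>X \<in> C1_processes M {a<..<b} Pt Ft. \<forall>P.
           P \<in> processes {a<..<b} Pt Ft \<or> P = canonical_momentum \<mu> M Pt Ft L X \<longrightarrow>
             (\<forall>t\<in>{a<..<b}. \<forall>\<omega>\<in>space M.
                S_H {a<..<b} (curve_functional H) X P t \<omega>
                  = stochastic_hamiltonian_system L f P X t \<omega>)"
proof -
  have H: "holomorphic_real H"
    using assms(3-5)
    by (auto simp: admissible_lagrangian_def legendre_transform_def
        intro: holomorphic_real_hamiltonian)
  have "S_H {a<..<b} (curve_functional H) X P t \<omega> = stochastic_hamiltonian_system L f P X t \<omega>"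
    if "t \<in> {a<..<b}" for X :: "real \<Rightarrow> 'w \<Rightarrow> real ^ 'd" and P t \<omega>
  proof -
    \<comment> \<open>Over an empty time interval every function of the class would represent the functional,
      and \<open>S_H\<close> could not recover \<open>H\<close>.\<close>
    have "{a<..<b} \<noteq> {}"
      using that by blast
    from S_H_curve_functional[OF H this] show ?thesis
      by (simp add: assms(5) hamiltonian_def stochastic_hamiltonian_system_def)
  qed
  then show ?thesis by blast
qed

end
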